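(* There is an absolute constant $C>0$ such that the following holds. Let $p$ be a prime, let $\mathcal{U},\mathcal{V}\subset\{0,1,\ldots,p-1\}$ be sets with $u$ and $v$ elements respectively, and let $S$ and $T$ be any integers with $1\le T\le p$. Let $J_2$ denote the number of triples of integers $(x,y,z)$ satisfying $$xy\equiv z\pmod p,\qquad x\in\mathcal{U},\quad y\in\mathcal{V},\quad S+1\le z\le S+T.$$ Then $$\left|J_2-\frac{uvT}{p}\right|\le C\left((u^2v^2T)^{1/3}+(puv)^{1/2}\right).$$ *)

theory Defs
  imports "HOL-Analysis.Analysis" "HOL-Number_Theory.Number_Theory"
begin

definition J2 :: "nat \<Rightarrow> int set \<Rightarrow> int set \<Rightarrow> int \<Rightarrow> int \<Rightarrow> nat" where
  "J2 p U V S T =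
     card {(x, y, z). [x * y = z] (mod int p) \<and> x \<in> U \<and> y \<in> V \<and> S + 1 \<le> z \<and> z \<le> S + T}"

end

(*
  Read x y = a + b (mod p) as an incidence between the point (x, a) and the line with parameters
  (y, b). Two distinct points lie on at most one common line, so the number of points of P on a
  line has variance at most |P| / p over all p^2 lines; Cauchy-Schwarz then gives
  |I(P, L) - |P| |L| / p| <= sqrt (p |P| |L|) without exponential sums. With a and b both ranging
  over intervals, b over one of length H, this counts H-fold averages of translates of the
  hyperbola-interval problem. Such averages bound J2 from both sides with no logarithmic loss, the
  boundary effect costing u v H / p, and H = p (T / (u v))^(1/3) balances the two errors.
*)
theory Submission
  imports Defs
begin

section \<open>Point-line incidences modulo a prime\<close>

definition incident :: "int \<Rightarrow> int \<times> int \<Rightarrow> int \<times> int \<Rightarrow> bool" where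
  "incident m q l \<longleftrightarrow> [fst q * fst l = snd q + snd l] (mod m)"

text \<open>Each \<open>y\<close> fixes the residue of the second parameter, so the lines through
  \<open>q\<close> form the graph of a function on \<open>{0..<m}\<close>.\<close>

lemma card_lines_through_point:
  assumes "m > 0"
  shows "card {l \<in> {0..<m} \<times> {0..<m}. incident m q l} = nat m"
proof -
  have "{l \<in> {0..<m} \<times> {0..<m}. incident m q l}
      = (\<lambda>y. (y, (fst q * y - snd q) mod m)) ` {0..<m}"
  proof (intro equalityI subsetI)
    fix l assume l: "l \<in> {l \<in> {0..<m} \<times> {0..<m}. incident m q l}"
    then have "m dvd - (fst q * fst l - (snd q + snd l))"
      unfolding dvd_minus_iff by (auto simp: incident_def cong_iff_dvd_diff)
    then have "snd l mod m = (fst q * fst l - snd q) mod m"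
      by (simp add: mod_eq_dvd_iff algebra_simps)
    with l have "l = (fst l, (fst q * fst l - snd q) mod m)"
      by (cases l) auto
    with l show "l \<in> (\<lambda>y. (y, (fst q * y - snd q) mod m)) ` {0..<m}"
      by (auto simp: image_iff)
  next
    fix l assume "l \<in> (\<lambda>y. (y, (fst q * y - snd q) mod m)) ` {0..<m}"
    with assms show "l \<in> {l \<in> {0..<m} \<times> {0..<m}. incident m q l}"
      by (auto simp: incident_def cong_def mod_add_right_eq)
  qed
  then show ?thesis
    by (simp add: card_image inj_on_def)
qed

text \<open>A second difference of the four incidences cancels the second coordinates and leaves
  \<open>(x - x') * (y - y')\<close>, which primality splits. If \<open>x\<close> and
  \<open>x'\<close> are congruent, a common line would force \<open>a\<close> and \<open>a'\<close>
  to be congruent too. Such vertically aligned points lie on no common line, hence a bound rather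
  than an equality.\<close>

lemma card_lines_through_two_points:
  fixes p :: int
  assumes p: "prime p"
    and ne: "\<not> ([fst q = fst q'] (mod p) \<and> [snd q = snd q'] (mod p))"
  shows "card {l \<in> {0..<p} \<times> {0..<p}. incident p q l \<and> incident p q' l} \<le> 1"
proof -
  let ?X = "{l \<in> {0..<p} \<times> {0..<p}. incident p q l \<and> incident p q' l}"
  have "l = l'" if l: "l \<in> ?X" and l': "l' \<in> ?X" for l l'
  proof -
    obtain x a x' a' y b y' b' where e: "q = (x, a)" "q' = (x', a')" "l = (y, b)" "l' = (y', b')"
      by (metis surj_pair)
    have d: "p dvd x * y - (a + b)" "p dvd x' * y - (a' + b)"
      "p dvd x * y' - (a + b')" "p dvd x' * y' - (a' + b')"
      using l l' by (auto simp: e incident_def cong_iff_dvd_diff)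
    have "p dvd (x * y - (a + b)) - (x' * y - (a' + b))
        - ((x * y' - (a + b')) - (x' * y' - (a' + b')))"
      using d by (meson dvd_diff)
    then have "p dvd (x - x') * (y - y')"
      by (simp add: algebra_simps)
    then have "p dvd x - x' \<or> p dvd y - y'"
      using p by (simp add: prime_dvd_mult_iff)
    moreover have False if h: "p dvd x - x'"
    proof -
      have "p dvd (x - x') * y - ((x * y - (a + b)) - (x' * y - (a' + b)))"
        using d h by (meson dvd_diff dvd_mult2)
      then have "p dvd a - a'"
        by (simp add: algebra_simps)
      with h ne show False
        by (simp add: e cong_iff_dvd_diff)
    qed
    ultimately have y: "p dvd y - y'"
      by blast
    have "p dvd x * (y - y') - ((x * y - (a + b)) - (x * y' - (a + b')))"
      using d y by (meson dvd_diff dvd_mult)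
    then have b: "p dvd b - b'"
      by (simp add: algebra_simps)
    have "y = y'" "b = b'"
      using l l' y b by (auto simp: e cong_iff_dvd_diff[symmetric] cong_def)
    then show ?thesis
      by (simp add: e)
  qed
  \<comment> \<open>If \<open>?X\<close> is empty, \<open>SOME\<close> returns an arbitrary line and
    the inclusion is still true.\<close>
  then have "?X \<subseteq> {SOME l. l \<in> ?X}"
    by (metis (no_types, lifting) singletonI someI_ex subsetI)
  then show ?thesis
    using card_mono[of "{SOME l. l \<in> ?X}" ?X] by simp
qed

text \<open>The square counts pairs of points on a common line: \<open>p\<close> lines for each
  diagonal pair, at most one for any other pair. Points are integer pairs, so \<open>inj\<close> has
  to ensure that they stay distinct modulo \<open>p\<close>.\<close>

lemma incidence_second_moment:
  fixes p :: int
  assumes p: "prime p" and P: "finite P"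
    and inj: "\<And>q q'. \<lbrakk>q \<in> P; q' \<in> P; [fst q = fst q'] (mod p); [snd q = snd q'] (mod p)\<rbrakk> \<Longrightarrow> q = q'"
  shows "(\<Sum>l\<in>{0..<p} \<times> {0..<p}. (real (card {q\<in>P. incident p q l}))\<^sup>2)
    \<le> p * card P + (real (card P))\<^sup>2"
proof -
  let ?R = "{0..<p} \<times> {0..<p}"
  let ?i = "\<lambda>q l. of_bool (incident p q l) :: real"
  have p0: "p > 0"
    using p by (simp add: prime_gt_0_int)
  \<comment> \<open>The extra 1 on the diagonal is harmless: adding 1 to all pairs gives exactly the
    square of \<open>card P\<close>.\<close>
  have two: "(\<Sum>l\<in>?R. ?i q l * ?i q' l) \<le> (if q' = q then real_of_int p else 0) + 1" if "q \<in> P" "q' \<in> P" for q q'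
  proof -
    have "(\<Sum>l\<in>?R. ?i q l * ?i q' l) = card {l \<in> ?R. incident p q l \<and> incident p q' l}"
      by (simp flip: of_bool_conj) (simp add: sum.If_cases of_bool_def Int_def)
    also have "\<dots> \<le> (if q' = q then real_of_int p else 0) + 1"
    proof (cases "q' = q")
      case True
      then show ?thesis
        using card_lines_through_point[OF p0, of q] p0 by simp
    next
      case False
      then show ?thesis
        using card_lines_through_two_points[OF p, of q q'] inj[of q q'] that by force
    qed
    finally show ?thesis
      by simp
  qed
  have "(\<Sum>l\<in>?R. (real (card {q\<in>P. incident p q l}))\<^sup>2) = (\<Sum>l\<in>?R. (\<Sum>q\<in>P. ?i q l)\<^sup>2)"
    using P by (simp add: sum.If_cases of_bool_def Int_def)
  also have "\<dots> = (\<Sum>l\<in>?R. \<Sum>q\<in>P. \<Sum>q'\<in>P. ?i q l * ?i q' l)"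
    by (simp only: power2_eq_square sum_product)
  also have "\<dots> = (\<Sum>q\<in>P. \<Sum>q'\<in>P. \<Sum>l\<in>?R. ?i q l * ?i q' l)"
    by (subst sum.swap) (intro sum.cong refl sum.swap)
  also have "\<dots> \<le> (\<Sum>q\<in>P. \<Sum>q'\<in>P. (if q' = q then real_of_int p else 0) + 1)"
    using two by (intro sum_mono) auto
  also have "\<dots> = p * card P + (real (card P))\<^sup>2"
    using P by (simp add: sum.distrib power2_eq_square sum.delta algebra_simps)
  finally show ?thesis .
qed

lemma incidence_first_moment:
  assumes "m > 0" and P: "finite P"
  shows "(\<Sum>l\<in>{0..<m} \<times> {0..<m}. real (card {q\<in>P. incident m q l})) = m * card P"
proof -
  let ?R = "{0..<m} \<times> {0..<m}"
  have "(\<Sum>l\<in>?R. real (card {q\<in>P. incident m q l})) = (\<Sum>l\<in>?R. \<Sum>q\<in>P. of_bool (incident m q l))"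
    using P by (simp add: sum.If_cases of_bool_def Int_def)
  also have "\<dots> = (\<Sum>q\<in>P. \<Sum>l\<in>?R. of_bool (incident m q l))"
    by (rule sum.swap)
  also have "\<dots> = (\<Sum>q\<in>P. real (card {l \<in> ?R. incident m q l}))"
    by (simp add: sum.If_cases of_bool_def Int_def)
  also have "\<dots> = m * card P"
    using assms by (simp add: card_lines_through_point)
  finally show ?thesis .
qed

lemma incidence_bound:
  fixes p :: int
  assumes p: "prime p" and P: "finite P" and L: "L \<subseteq> {0..<p} \<times> {0..<p}"
    and inj: "\<And>q q'. \<lbrakk>q \<in> P; q' \<in> P; [fst q = fst q'] (mod p); [snd q = snd q'] (mod p)\<rbrakk> \<Longrightarrow> q = q'"
  shows "\<bar>(\<Sum>l\<in>L. real (card {q\<in>P. incident p q l})) - real (card P) * card L / p\<bar>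
    \<le> sqrt (p * card P * card L)"
proof -
  let ?R = "{0..<p} \<times> {0..<p}"
  let ?n = "real (card P)"
  define f where "f l = real (card {q\<in>P. incident p q l})" for l
  define g where "g l = f l - ?n / p" for l
  have p0: "p > 0"
    using p by (simp add: prime_gt_0_int)
  have "finite L"
    using L by (rule finite_subset) simp
  have "(\<Sum>l\<in>?R. (g l)\<^sup>2) = (\<Sum>l\<in>?R. (f l)\<^sup>2 - 2 * (?n / p) * f l + (?n / p)\<^sup>2)"
    by (simp add: g_def power2_diff algebra_simps)
  also have "\<dots> = (\<Sum>l\<in>?R. (f l)\<^sup>2) - 2 * (?n / p) * (\<Sum>l\<in>?R. f l) + ?n\<^sup>2"
    using p0 by (simp only: sum.distrib sum_subtractf sum_distrib_left)
      (simp add: card_cartesian_product power2_eq_square)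
  \<comment> \<open>The second moment contributes \<open>?n\<^sup>2\<close>, the cross term
    \<open>- 2 * ?n\<^sup>2\<close> and the squared mean \<open>?n\<^sup>2\<close>. These cancel,
    and only the diagonal contribution is left.\<close>
  also have "\<dots> \<le> p * ?n"
  proof -
    have "2 * (?n / p) * (\<Sum>l\<in>?R. f l) = 2 * ?n\<^sup>2"
      using incidence_first_moment[OF p0 P] p0 by (simp add: f_def power2_eq_square)
    then show ?thesis
      using incidence_second_moment[OF p P inj] by (simp add: f_def)
  qed
  finally have var: "(\<Sum>l\<in>?R. (g l)\<^sup>2) \<le> p * ?n" .
  have "(\<Sum>l\<in>L. g l)\<^sup>2 \<le> (\<Sum>l\<in>L. (g l)\<^sup>2) * card L"
    using Cauchy_Schwarz_ineq_sum[of g "\<lambda>_. 1" L] by simp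
  also have "\<dots> \<le> (\<Sum>l\<in>?R. (g l)\<^sup>2) * card L"
    using L by (intro mult_right_mono sum_mono2) auto
  also have "\<dots> \<le> p * ?n * card L"
    using var by (intro mult_right_mono) auto
  finally have "\<bar>\<Sum>l\<in>L. g l\<bar> \<le> sqrt (p * ?n * card L)"
    by (simp add: real_le_rsqrt)
  moreover have "(\<Sum>l\<in>L. g l) = (\<Sum>l\<in>L. f l) - ?n * card L / p"
    by (simp add: g_def sum_subtractf)
  ultimately show ?thesis
    by (simp add: f_def)
qed

section \<open>Elementary properties of \<open>J2\<close> and its incidence form\<close>

lemma J2_set_finite:
  assumes "finite U" "finite V"
  shows "finite {(x, y, z). [x * y = z] (mod m) \<and> x \<in> U \<and> y \<in> V \<and> S + 1 \<le> z \<and> z \<le> S + (T::int)}"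
  by (rule finite_subset[of _ "U \<times> V \<times> {S + 1..S + T}"]) (use assms in auto)

lemma J2_mono:
  assumes "finite U" "finite V" "S' \<le> S" "S + T \<le> S' + T'"
  shows "J2 p U V S T \<le> J2 p U V S' T'"
  unfolding J2_def using assms by (intro card_mono J2_set_finite) auto

lemma J2_split:
  assumes "finite U" "finite V" "0 \<le> T1" "0 \<le> T2"
  shows "J2 p U V S (T1 + T2) = J2 p U V S T1 + J2 p U V (S + T1) T2"
  unfolding J2_def using assms
  by (subst card_Un_disjoint[symmetric]) (auto intro!: J2_set_finite arg_cong[where f=card])

text \<open>Writing \<open>z = a + b\<close> moves the translation \<open>b\<close> into the line
  and leaves the same point set for every \<open>b\<close>. Summing over \<open>b\<close> therefore
  becomes a single incidence count.\<close>

lemma J2_eq_sum: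
  assumes "finite U" "finite V"
  shows "J2 p U V (s + b) t
    = (\<Sum>y\<in>V. card {q \<in> U \<times> {s + 1..s + t}. incident (int p) q (y, b)})"
proof -
  let ?A = "\<lambda>y. {q \<in> U \<times> {s + 1..s + t}. incident (int p) q (y, b)}"
  let ?Z = "{(x, y, z). [x * y = z] (mod int p) \<and> x \<in> U \<and> y \<in> V \<and> s + b + 1 \<le> z \<and> z \<le> s + b + t}"
  have "bij_betw (\<lambda>(y, x, a). (x, y, a + b)) (Sigma V ?A) ?Z"
    by (rule bij_betw_byWitness[where f' = "\<lambda>(x, y, z). (y, x, z - b)"])
      (auto simp: incident_def)
  then have "card (Sigma V ?A) = J2 p U V (s + b) t"
    unfolding J2_def by (rule bij_betw_same_card)
  then show ?thesis
    using assms by (simp add: card_SigmaI)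
qed

section \<open>Averages over translates, and comparison with one interval\<close>

text \<open>The bound on \<open>t\<close> keeps the points distinct modulo \<open>p\<close>, and the
  bound on \<open>H\<close> keeps the lines within the standard representatives.\<close>

lemma J2_average_bound:
  assumes p: "prime p" and U: "U \<subseteq> {0..int p - 1}" and V: "V \<subseteq> {0..int p - 1}"
    and t: "0 \<le> t" "t \<le> int p" and H: "0 \<le> H" "H \<le> int p"
  shows "\<bar>(\<Sum>b\<in>{0..<H}. real (J2 p U V (s + b) t)) - real (card U) * card V * t * H / p\<bar>
    \<le> sqrt (real p * card U * card V * t * H)"
proof -
  let ?P = "U \<times> {s + 1..s + t}" and ?L = "V \<times> {0..<H}"
  have fin: "finite U" "finite V"
    using U V finite_subset by auto
  have inj: "q = q'" if q: "q \<in> ?P" "q' \<in> ?P"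
    and c: "[fst q = fst q'] (mod int p)" "[snd q = snd q'] (mod int p)" for q q'
  proof -
    have "fst q = fst q'"
      using q c(1) U by (auto simp: cong_def subset_iff)
    \<comment> \<open>The offset \<open>s\<close> is arbitrary, so both coordinates are first
      shifted into \<open>{0..<p}\<close>, where congruence means equality.\<close>
    moreover have "snd q - (s + 1) = snd q' - (s + 1)"
    proof (rule cong_less_imp_eq_int[of _ "int p"])
      show "[snd q - (s + 1) = snd q' - (s + 1)] (mod int p)"
        using c(2) by (intro cong_diff) auto
    qed (use q t in auto)
    ultimately show ?thesis
      by (simp add: prod_eq_iff)
  qed
  have "(\<Sum>b\<in>{0..<H}. real (J2 p U V (s + b) t))
      = (\<Sum>b\<in>{0..<H}. \<Sum>y\<in>V. real (card {q \<in> ?P. incident (int p) q (y, b)}))"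
    using fin by (simp add: J2_eq_sum)
  also have "\<dots> = (\<Sum>l\<in>?L. real (card {q \<in> ?P. incident (int p) q l}))"
    by (subst sum.swap) (simp add: sum.cartesian_product)
  finally have eq: "(\<Sum>b\<in>{0..<H}. real (J2 p U V (s + b) t))
    = (\<Sum>l\<in>?L. real (card {q \<in> ?P. incident (int p) q l}))" .
  have "prime (int p)" "finite ?P" "?L \<subseteq> {0..<int p} \<times> {0..<int p}"
    using p fin V H by auto
  from incidence_bound[OF this inj] show ?thesis
    using t H by (simp add: eq card_cartesian_product mult_ac)
qed

text \<open>The condition \<open>T + H - 1 \<le> p\<close> keeps the enlarged interval of the upper bound from
  wrapping around modulo \<open>p\<close>.\<close>

lemma J2_smoothed_bound:
  assumes p: "prime p" and U: "U \<subseteq> {0..int p - 1}" and V: "V \<subseteq> {0..int p - 1}"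
    and H: "1 \<le> H" "H \<le> T" and T: "T + H - 1 \<le> int p"
  shows "\<bar>real (J2 p U V S T) - real (card U) * card V * T / p\<bar>
    \<le> real (card U) * card V * (H - 1) / p + sqrt (2 * (real p * card U * card V * T / H))"
proof -
  let ?w = "real (card U) * card V"
  have fin: "finite U" "finite V"
    using U V finite_subset by auto
  have p0: "real p > 0"
    using p by (simp add: prime_gt_0_nat)
  have h0: "real_of_int H > 0"
    using H by simp
  \<comment> \<open>Both interval lengths used below, \<open>T + H - 1\<close> and
    \<open>T - H + 1\<close>, are at most \<open>2 * T\<close>; this is the source of the factor 2
    under the root.\<close>
  have sq: "sqrt (real p * card U * card V * t * H) \<le> H * sqrt (2 * (real p * card U * card V * T / H))"
    if "0 \<le> t" "t \<le> 2 * T" for t :: int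
  proof -
    have "real p * card U * card V * t * H \<le> real p * card U * card V * (2 * T) * H"
      using that h0 by (intro mult_right_mono mult_left_mono) auto
    also have "\<dots> = H\<^sup>2 * (2 * (real p * card U * card V * T / H))"
      using h0 by (simp add: field_simps power2_eq_square)
    finally have "sqrt (real p * card U * card V * t * H)
      \<le> sqrt (H\<^sup>2 * (2 * (real p * card U * card V * T / H)))"
      by (rule real_sqrt_le_mono)
    also have "\<dots> = H * sqrt (2 * (real p * card U * card V * T / H))"
      unfolding real_sqrt_mult[of "H\<^sup>2"] using h0 by simp
    finally show ?thesis .
  qed
  have up: "real (J2 p U V S T) \<le> ?w * (T + H - 1) / p + sqrt (2 * (real p * card U * card V * T / H))"
  proof -
    have "H * real (J2 p U V S T) = (\<Sum>b\<in>{0..<H}. real (J2 p U V S T))"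
      using H by simp
    \<comment> \<open>For \<open>b\<close> from 0 to \<open>H - 1\<close>, each of these longer
      intervals contains the original one.\<close>
    also have "\<dots> \<le> (\<Sum>b\<in>{0..<H}. real (J2 p U V (S + 1 - H + b) (T + H - 1)))"
      using fin by (intro sum_mono) (auto intro!: J2_mono)
    also have "\<dots> \<le> ?w * (T + H - 1) * H / p + sqrt (real p * card U * card V * (T + H - 1) * H)"
      using J2_average_bound[OF p U V, of "T + H - 1" H "S + 1 - H"] H T by simp
    also have "\<dots> \<le> ?w * (T + H - 1) * H / p + H * sqrt (2 * (real p * card U * card V * T / H))"
      using sq[of "T + H - 1"] H by simp
    also have "\<dots> = H * (?w * (T + H - 1) / p + sqrt (2 * (real p * card U * card V * T / H)))"
      by (simp add: algebra_simps)
    finally show ?thesis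
      using h0 by (simp only: mult_le_cancel_left_pos)
  qed
  have low: "?w * (T - H + 1) / p - sqrt (2 * (real p * card U * card V * T / H)) \<le> real (J2 p U V S T)"
  proof -
    have "H * (?w * (T - H + 1) / p - sqrt (2 * (real p * card U * card V * T / H)))
        = ?w * (T - H + 1) * H / p - H * sqrt (2 * (real p * card U * card V * T / H))"
      by (simp add: algebra_simps)
    also have "\<dots> \<le> ?w * (T - H + 1) * H / p - sqrt (real p * card U * card V * (T - H + 1) * H)"
      using sq[of "T - H + 1"] H by simp
    also have "\<dots> \<le> (\<Sum>b\<in>{0..<H}. real (J2 p U V (S + b) (T - H + 1)))"
      using J2_average_bound[OF p U V, of "T - H + 1" H S] H T by simp
    \<comment> \<open>Dually, all \<open>H\<close> shortened intervals lie inside the original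
      one.\<close>
    also have "\<dots> \<le> (\<Sum>b\<in>{0..<H}. real (J2 p U V S T))"
      using fin by (intro sum_mono) (auto intro!: J2_mono)
    also have "\<dots> = H * real (J2 p U V S T)"
      using H by simp
    finally show ?thesis
      using h0 by (simp only: mult_le_cancel_left_pos)
  qed
  have eq: "?w * (T + H - 1) / p = ?w * T / p + ?w * (H - 1) / p"
    "?w * (T - H + 1) / p = ?w * T / p - ?w * (H - 1) / p"
    by (simp_all add: algebra_simps flip: diff_divide_distrib add_divide_distrib)
  show ?thesis
    using up low unfolding eq by (simp add: abs_le_iff)
qed

section \<open>Choice of the averaging length\<close>

text \<open>The restriction on \<open>T\<close> gives \<open>T + H - 1 \<le> p\<close> for every
  \<open>H \<le> T\<close>, so the averaging length can be chosen freely up to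
  \<open>T\<close>.\<close>

lemma J2_bound_short:
  assumes p: "prime p" and U: "U \<subseteq> {0..int p - 1}" and V: "V \<subseteq> {0..int p - 1}"
    and T: "1 \<le> T" "2 * T \<le> int p + 1"
  shows "\<bar>real (J2 p U V S T) - real (card U) * card V * T / p\<bar>
    \<le> 3 * (root 3 ((real (card U))\<^sup>2 * (real (card V))\<^sup>2 * T) + sqrt (real p * card U * card V))"
\<comment> \<open>The optimal length divides by the product of the cardinalities, so an empty set is
  treated apart, with \<open>H = 1\<close>.\<close>
proof (cases "card U * card V = 0")
  case True
  then have w: "real (card U) * card V = 0" "real p * card U * card V = 0"
    by auto
  have "\<bar>real (J2 p U V S T) - real (card U) * card V * T / p\<bar> \<le> 0"
    using J2_smoothed_bound[OF p U V, of 1 T S] T unfolding w by simp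
  then show ?thesis
    by (rule order_trans) (use T in simp)
next
  case False
  define w where "w = real (card U) * card V"
  define r where "r = root 3 (w\<^sup>2 * T)"
  \<comment> \<open>The real balancing point: it makes \<open>w * K / p = r\<close> and
    \<open>p * w * T / K = r\<^sup>2\<close>.\<close>
  define K where "K = p * r / w"
  define H where "H = min \<lceil>K\<rceil> T"
  have p0: "real p > 0"
    using p by (simp add: prime_gt_0_nat)
  have w0: "w > 0"
    using False by (simp add: w_def)
  have r0: "r > 0"
    using w0 T by (simp add: r_def)
  have r3: "r ^ 3 = w\<^sup>2 * T"
    using T by (simp add: r_def)
  have K0: "K > 0"
    using p0 w0 r0 by (simp add: K_def)
  have H: "1 \<le> H" "H \<le> T"
    using K0 T by (auto simp: H_def)
  \<comment> \<open>Rounding \<open>K\<close> up costs nothing, since the boundary term contains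
    \<open>H - 1\<close> and not \<open>H\<close>.\<close>
  have "w * (H - 1) / p \<le> w * K / p"
    using w0 p0 by (intro divide_right_mono mult_left_mono) (auto simp: H_def min_def, linarith)
  also have "\<dots> = r"
    using w0 p0 by (simp add: K_def)
  finally have main: "w * (H - 1) / p \<le> r" .
  \<comment> \<open>The term \<open>r\<^sup>2\<close> covers the balanced length. When
    \<open>H\<close> is cut off at \<open>T\<close>, the quotient is \<open>p * w\<close>, which
    yields the second error term.\<close>
  have "p * w * T / H \<le> r\<^sup>2 + p * w"
  proof (cases "\<lceil>K\<rceil> \<le> T")
    case True
    then have "K \<le> H"
      by (simp add: H_def)
    then have "p * w * T / H \<le> p * w * T / K"
      using p0 w0 K0 T by (intro divide_left_mono) auto
    also have "\<dots> = r\<^sup>2"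
      using p0 w0 r0 r3 by (simp add: K_def field_simps power2_eq_square power3_eq_cube)
    finally show ?thesis
      using p0 w0 by (simp add: add_increasing2)
  next
    case False
    then show ?thesis
      using H T by (simp add: H_def)
  qed
  then have "sqrt (2 * (p * w * T / H)) \<le> sqrt (2 * (r\<^sup>2 + p * w))"
    by simp
  also have "\<dots> = sqrt 2 * sqrt (r\<^sup>2 + p * w)"
    by (rule real_sqrt_mult)
  \<comment> \<open>Rounding \<open>sqrt 2\<close> up to 2 and adding one \<open>r\<close> for the
    boundary gives the constant 3.\<close>
  also have "\<dots> \<le> 2 * (r + sqrt (p * w))"
  proof (rule mult_mono)
    show "sqrt (r\<^sup>2 + p * w) \<le> r + sqrt (p * w)"
      using sqrt_add_le_add_sqrt[of "r\<^sup>2" "p * w"] r0 w0 by simp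
  qed (use r0 w0 sqrt2_less_2 in auto)
  finally have sq: "sqrt (2 * (p * w * T / H)) \<le> 2 * (r + sqrt (p * w))" .
  have "\<bar>real (J2 p U V S T) - w * T / p\<bar> \<le> w * (H - 1) / p + sqrt (2 * (p * w * T / H))"
    using J2_smoothed_bound[OF p U V H, of S] H T by (simp add: w_def mult_ac)
  also have "\<dots> \<le> r + 2 * (r + sqrt (p * w))"
    by (rule add_mono[OF main sq])
  also have "\<dots> \<le> 3 * (r + sqrt (p * w))"
    using w0 by simp
  finally have "\<bar>real (J2 p U V S T) - w * T / p\<bar> \<le> 3 * (r + sqrt (p * w))" .
  then show ?thesis
    by (simp add: w_def r_def power_mult_distrib mult_ac)
qed

theorem theorem3:
  shows "\<exists>C::real. C > 0 \<and>
    (\<forall>(p::nat) (U::int set) (V::int set) (u::nat) (v::nat) (S::int) (T::int).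
       prime p \<longrightarrow>
       U \<subseteq> {0..int p - 1} \<longrightarrow> V \<subseteq> {0..int p - 1} \<longrightarrow>
       card U = u \<longrightarrow> card V = v \<longrightarrow>
       1 \<le> T \<longrightarrow> T \<le> int p \<longrightarrow>
       \<bar>real (J2 p U V S T) - real u * real v * real_of_int T / real p\<bar>
         \<le> C * (root 3 ((real u)\<^sup>2 * (real v)\<^sup>2 * real_of_int T)
                + sqrt (real p * real u * real v)))"
proof (intro exI[of _ 6] conjI allI impI)
  fix p :: nat and U V :: "int set" and u v :: nat and S T :: int
  assume p: "prime p" and U: "U \<subseteq> {0..int p - 1}" and V: "V \<subseteq> {0..int p - 1}"
    and u: "card U = u" and v: "card V = v" and T: "1 \<le> T" "T \<le> int p"
  define D where "D S T = real (J2 p U V S T) - real u * v * real_of_int T / p" for S T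
  define E where "E T = root 3 ((real u)\<^sup>2 * (real v)\<^sup>2 * real_of_int T)
                + sqrt (real p * real u * real v)" for T
  have short: "\<bar>D S T'\<bar> \<le> 3 * E T" if "1 \<le> T'" "T' \<le> T" "2 * T' \<le> int p + 1" for S T'
  proof -
    have "\<bar>D S T'\<bar> \<le> 3 * E T'"
      using J2_bound_short[OF p U V, of T' S] that by (simp add: D_def E_def u v)
    also have "E T' \<le> E T"
      using that by (simp add: E_def mult_left_mono)
    finally show ?thesis
      by simp
  qed
  have "\<bar>D S T\<bar> \<le> 6 * E T"
  \<comment> \<open>Length 1 would leave an empty half; it is already short because \<open>p\<close>
    is at least 1.\<close>
  proof (cases "T = 1")
    case True
    moreover have "0 \<le> E T"
      using T by (simp add: E_def)
    ultimately show ?thesis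
      using short[of T S] T by simp
  next
    case False
    \<comment> \<open>The larger half satisfies \<open>2 * T2 \<le> T + 1 \<le> p + 1\<close>, which
      is exactly the allowance for short intervals. The main term is linear in the length, so the
      two errors add up to \<open>3 + 3 = 6\<close>.\<close>
    define T1 T2 where "T1 = T div 2" and "T2 = T - T div 2"
    have T12: "1 \<le> T1" "T1 \<le> T" "2 * T1 \<le> int p + 1" "1 \<le> T2" "T2 \<le> T" "2 * T2 \<le> int p + 1"
      "T = T1 + T2"
      using T False by (auto simp: T1_def T2_def)
    have "finite U" "finite V"
      using U V finite_subset by auto
    then have "D S T = D S T1 + D (S + T1) T2"
      using J2_split[of U V T1 T2 p S] T12 by (simp add: D_def field_simps)
    then show ?thesis
      using short[of T1 S] short[of T2 "S + T1"] T12 by linarith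
  qed
  then show "\<bar>real (J2 p U V S T) - real u * real v * real_of_int T / real p\<bar>
         \<le> 6 * (root 3 ((real u)\<^sup>2 * (real v)\<^sup>2 * real_of_int T)
                + sqrt (real p * real u * real v))"
    by (simp add: D_def E_def)
qed simp

end
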